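(* Let $p,q\ge 2$ be integers. The only minimal hypersurface of $\mathbb{R}^{p+q}$, invariant by $O(p)\times O(q)$, with one cusp point at the origin, is the cone $$C=\left\{(U,V)\in\mathbb{R}^q\times\mathbb{R}^p:\ (q-1)|V|^2=(p-1)|U|^2\right\}.$$ Moreover, this minimal cone has profile curve $y=(\tan\alpha_0)x=\sqrt{\frac{p-1}{q-1}}\,x$ and principal curvatures $$\lambda_1(t)=0,\qquad \lambda_2(t)=\frac1t\sqrt{\frac{p-1}{q-1}},\qquad \lambda_3(t)=-\frac1t\sqrt{\frac{q-1}{p-1}}.$$
   Context: Write $\mathbb{R}^{p+q}=\mathbb{R}^q\times\mathbb{R}^p$, with points $(U,V)$, $O(q)$ acting on the first factor and $O(p)$ on the second in the standard way. The orbit space coordinates are $x=|U|$, $y=|V|$; let $Q_1=\{(x,y): x>0,\ y>0\}$. A curve $\gamma(t)=(x(t),y(t))$ in $Q_1$ (the profile curve) generates the invariant hypersurface $\{(x(t)\xi,y(t)\eta):\ \xi\in\mathbb{S}^{q-1},\ \eta\in\mathbb{S}^{p-1}\}$. With $W=\sqrt{x'^2+y'^2}$, its principal curvatures are $\lambda_1=\frac{x'y''-x''y'}{W^3}$ (multiplicity $1$), $\lambda_2=\frac{y'}{xW}$ (multiplicity $q-1$), $\lambda_3=-\frac{x'}{yW}$ (multiplicity $p-1$). The hypersurface is minimal when $\lambda_1+(q-1)\lambda_2+(p-1)\lambda_3=0$. "With one cusp point at the origin" means that the profile curve is a global solution of this minimality equation with one cusp point at the origin: a continuous curve $\gamma:\mathbb{R}\to\{x\ge0,y\ge0\}$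 such that, for some $t_0$, $\gamma(t_0)=(0,0)$, $\gamma(t)\in Q_1$ for all $t\ne t_0$, and $\gamma$ is a smooth arc-length parametrized solution of the equation on $(-\infty,t_0)$ and on $(t_0,\infty)$. (The two branches are allowed to have the same image.) The hypersurface is identified with its image, together with the origin. In the formulas for the principal curvatures, the profile line is parametrized by $x(t)=t\cos\alpha_0$, $y(t)=t\sin\alpha_0$, $t>0$, where $\alpha_0=\arctan\sqrt{\frac{p-1}{q-1}}$. *)

theory Defs
  imports "HOL-Analysis.Analysis"
begin

text \<open>
  The ambient space \<open>\<real>\<^sup>p\<^sup>+\<^sup>q = \<real>\<^sup>q \<times> \<real>\<^sup>p\<close> is \<^typ>\<open>(real ^ 'q) \<times> (real ^ 'p)\<close>, with
  \<open>q = CARD('q)\<close> and \<open>p = CARD('p)\<close>; its Euclidean structure is that of the product.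
\<close>

definition OO_invariant :: "((real ^ 'q) \<times> (real ^ 'p)) set \<Rightarrow> bool" where
  "OO_invariant S \<longleftrightarrow>
     (\<forall>A B. orthogonal_transformation A \<and> orthogonal_transformation B \<longrightarrow>
        (\<lambda>(U, V). (A U, B V)) ` S = S)"

definition Q1 :: "(real \<times> real) set" where
  "Q1 = {(x, y). x > 0 \<and> y > 0}"

definition orbit_map :: "(real ^ 'q) \<times> (real ^ 'p) \<Rightarrow> real \<times> real" where
  "orbit_map = (\<lambda>(U, V). (norm U, norm V))"

definition generated_by :: "real set \<Rightarrow> (real \<Rightarrow> real \<times> real) \<Rightarrow> ((real ^ 'q) \<times> (real ^ 'p)) set" where
  "generated_by T \<gamma> =
     {(fst (\<gamma> t) *\<^sub>R \<xi>, snd (\<gamma> t) *\<^sub>R \<eta>) | t \<xi> \<eta>. t \<in> T \<and> norm \<xi> = 1 \<and> norm \<eta> = 1}"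

text \<open>
  Principal curvatures of the hypersurface generated by the profile curve \<open>(x, y)\<close>.
  \<open>lambda1\<close> has multiplicity \<open>1\<close>, \<open>lambda2\<close> has multiplicity \<open>q - 1\<close>, and \<open>lambda3\<close>
  has multiplicity \<open>p - 1\<close>.
\<close>

definition speed :: "(real \<Rightarrow> real) \<Rightarrow> (real \<Rightarrow> real) \<Rightarrow> real \<Rightarrow> real" where
  "speed x y t = sqrt ((deriv x t)\<^sup>2 + (deriv y t)\<^sup>2)"

definition lambda1 :: "(real \<Rightarrow> real) \<Rightarrow> (real \<Rightarrow> real) \<Rightarrow> real \<Rightarrow> real" where
  "lambda1 x y t =
     (deriv x t * deriv (deriv y) t - deriv (deriv x) t * deriv y t) / speed x y t ^ 3"

definition lambda2 :: "(real \<Rightarrow> real) \<Rightarrow> (real \<Rightarrow> real) \<Rightarrow> real \<Rightarrow> real" where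
  "lambda2 x y t = deriv y t / (x t * speed x y t)"

definition lambda3 :: "(real \<Rightarrow> real) \<Rightarrow> (real \<Rightarrow> real) \<Rightarrow> real \<Rightarrow> real" where
  "lambda3 x y t = - (deriv x t / (y t * speed x y t))"

definition minimal_at :: "nat \<Rightarrow> nat \<Rightarrow> (real \<Rightarrow> real) \<Rightarrow> (real \<Rightarrow> real) \<Rightarrow> real \<Rightarrow> bool" where
  "minimal_at p q x y t \<longleftrightarrow>
     lambda1 x y t + (real q - 1) * lambda2 x y t + (real p - 1) * lambda3 x y t = 0"

text \<open>
  \<open>C\<^sup>\<infinity>\<close> on a set \<open>T\<close>. Only meant for open \<open>T\<close>, since \<^const>\<open>deriv\<close> is the two-sided derivative.
\<close>

definition smooth_on :: "real set \<Rightarrow> (real \<Rightarrow> real) \<Rightarrow> bool" where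
  "smooth_on T f \<longleftrightarrow> (\<forall>k. \<forall>t\<in>T. (deriv ^^ k) f field_differentiable (at t))"

text \<open>
  A global solution of the minimality equation with one cusp point at the origin, reached at
  parameter \<open>t0\<close>. The two branches may have the same image.
\<close>

definition cusp_profile :: "nat \<Rightarrow> nat \<Rightarrow> real \<Rightarrow> (real \<Rightarrow> real \<times> real) \<Rightarrow> bool" where
  "cusp_profile p q t0 \<gamma> \<longleftrightarrow>
     continuous_on UNIV \<gamma> \<and>
     \<gamma> t0 = (0, 0) \<and>
     (\<forall>t. t \<noteq> t0 \<longrightarrow> \<gamma> t \<in> Q1) \<and>
     (\<forall>T \<in> {{..<t0}, {t0<..}}.
        smooth_on T (fst \<circ> \<gamma>) \<and> smooth_on T (snd \<circ> \<gamma>) \<and>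
        (\<forall>t\<in>T. speed (fst \<circ> \<gamma>) (snd \<circ> \<gamma>) t = 1 \<and>
                minimal_at p q (fst \<circ> \<gamma>) (snd \<circ> \<gamma>) t))"

text \<open>
  Hypersurfaces are identified with their images. The origin is included in
  \<open>generated_by UNIV \<gamma>\<close>, as the contribution of the parameter \<open>t0\<close>. The first
  conjunct follows from the second and records the symmetry explicitly.
\<close>

definition minimal_hypersurface_with_cusp :: "((real ^ 'q) \<times> (real ^ 'p)) set \<Rightarrow> bool" where
  "minimal_hypersurface_with_cusp S \<longleftrightarrow>
     OO_invariant S \<and>
     (\<exists>t0 \<gamma>. cusp_profile CARD('p) CARD('q) t0 \<gamma> \<and> S = generated_by UNIV \<gamma>)"

definition OO_cone :: "((real ^ 'q) \<times> (real ^ 'p)) set" where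
  "OO_cone = {(U, V). (real CARD('q) - 1) * (norm V)\<^sup>2 = (real CARD('p) - 1) * (norm U)\<^sup>2}"

definition alpha0 :: "nat \<Rightarrow> nat \<Rightarrow> real" where
  "alpha0 p q = arctan (sqrt ((real p - 1) / (real q - 1)))"

end

theory Submission
  imports Defs
begin

text \<open>
  Put \<open>a = q - 1\<close>, \<open>b = p - 1\<close>. In polar coordinates \<open>(r, \<theta>)\<close> of the quadrant, let \<open>\<psi>\<close> be the
  angle from the radial direction to the tangent. A unit speed minimal profile satisfies
  \<open>r \<theta>' = sin \<psi>\<close> and \<open>r \<psi>' = cos \<psi> (b cot \<theta> - a tan \<theta>) - (a + b + 1) sin \<psi>\<close>.
  On a branch issuing from the origin, \<open>x\<^sup>a y\<^sup>b r r'\<close> has positive derivative and vanishes in the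
  limit, so \<open>cos \<psi> = r' > 0\<close>. Hence the density \<open>F = cos\<^sup>a \<theta> sin\<^sup>b \<theta> cos \<psi>\<close> is nondecreasing; its
  greatest possible value is attained only by the cone. If \<open>F\<close> were below that value at some point
  of the branch, it would stay below it on the way back to the origin, and there the bounded function
  \<open>H = K F\<^bsup>1/(a+b)\<^esup> + (b cos\<^sup>2 \<theta> - a sin\<^sup>2 \<theta>) sin \<psi>\<close> would have derivative at least \<open>\<delta> > 0\<close>
  with respect to \<open>ln r\<close>. This is impossible because \<open>ln r\<close> tends to \<open>-\<infinity>\<close>.
\<close>

section \<open>Inequalities for the angular density\<close>

text \<open>This is the Gibbs inequality for the distributions \<open>(A\<^sup>2, B\<^sup>2)\<close>
  and \<open>(a / N, b / N)\<close>: the bound \<open>ln z \<le> z - 1\<close> is applied to the two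
  ratios. Equality forces both ratios to be 1, which is the angle of the cone.\<close>

lemma weighted_log_bound:
  fixes a b A B :: real
  assumes "a > 0" "b > 0" "A > 0" "B > 0" "A\<^sup>2 + B\<^sup>2 = 1"
  defines "N \<equiv> a + b"
  shows "a * ln A + b * ln B \<le> (a * ln (a / N) + b * ln (b / N)) / 2" (is ?le)
    and "a * ln A + b * ln B = (a * ln (a / N) + b * ln (b / N)) / 2 \<Longrightarrow> b * A\<^sup>2 = a * B\<^sup>2"
proof -
  have N: "N > 0" using assms by simp
  define z where "z = N * A\<^sup>2 / a"
  define w where "w = N * B\<^sup>2 / b"
  have zw: "z > 0" "w > 0" using assms N by (simp_all add: z_def w_def)
  have lz: "ln z = 2 * ln A - ln (a / N)" and lw: "ln w = 2 * ln B - ln (b / N)"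
    using assms N by (simp_all add: z_def w_def ln_mult ln_div ln_realpow)
  have "a * (z - 1) = N * A\<^sup>2 - a" "b * (w - 1) = N * B\<^sup>2 - b"
    using assms(1,2) by (simp_all add: z_def w_def field_simps)
  then have "a * (z - 1) + b * (w - 1) = N * (A\<^sup>2 + B\<^sup>2) - N"
    by (simp add: N_def algebra_simps)
  then have sum0: "a * (z - 1) + b * (w - 1) = 0" using assms by simp
  have 1: "a * ln z \<le> a * (z - 1)" "b * ln w \<le> b * (w - 1)"
    using ln_le_minus_one[OF zw(1)] ln_le_minus_one[OF zw(2)] assms by simp_all
  have e: "a * ln z + b * ln w
      = 2 * (a * ln A + b * ln B) - (a * ln (a / N) + b * ln (b / N))"
    unfolding lz lw by (simp add: algebra_simps)
  have "a * ln z + b * ln w \<le> 0" using 1 sum0 by linarith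
  then show ?le by (simp add: e)
  assume "a * ln A + b * ln B = (a * ln (a / N) + b * ln (b / N)) / 2"
  then have "a * ln z + b * ln w = 0" unfolding e by simp
  then have "a * ln z = a * (z - 1)" "b * ln w = b * (w - 1)" using 1 sum0 by linarith+
  then have "z = 1" "w = 1" using ln_eq_minus_one zw assms by auto
  then have "N * A\<^sup>2 = a" "N * B\<^sup>2 = b" using assms by (auto simp: z_def w_def field_simps)
  then have "N * (b * A\<^sup>2) = N * (a * B\<^sup>2)"
    by (metis mult.commute mult.left_commute)
  then show "b * A\<^sup>2 = a * B\<^sup>2" using N by simp
qed

text \<open>The left side will bound r H' from below, and \<open>c\<close> is r (ln r)'. Below the
  level of the cone, the angle or the direction differs from that of the cone by a fixed amount.
  Near the axes, where \<open>A * B\<close> tends to 0, uniformity comes from playing the two terms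
  against each other.\<close>

lemma lyapunov_rate_bound:
  fixes a b m1 :: real
  assumes a: "a \<ge> 1" and b: "b \<ge> 1"
  defines "N \<equiv> a + b"
  assumes l: "m1 < (a * ln (a / N) + b * ln (b / N)) / 2"
  obtains \<delta> where "\<delta> > 0"
    and "\<And>A B c s. \<lbrakk>A > 0; B > 0; A\<^sup>2 + B\<^sup>2 = 1; c > 0; c\<^sup>2 + s\<^sup>2 = 1; a * ln A + b * ln B + ln c \<le> m1\<rbrakk>
      \<Longrightarrow> (b * A\<^sup>2 - a * B\<^sup>2)\<^sup>2 * c\<^sup>2 / (2 * (A * B)) + A * B * s\<^sup>2 \<ge> \<delta> * c"
proof -
  have N: "N > 0" using a b by (simp add: N_def)
  define m0 where "m0 = (a * ln (a / N) + b * ln (b / N)) / 2"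
  \<comment> \<open>Half of the gap: an angle whose log weight is within \<epsilon> of the maximum
    still leaves a deficit of at least \<epsilon> to \<open>ln c\<close>.\<close>
  define \<epsilon> where "\<epsilon> = (m0 - m1) / 2"
  have \<epsilon>: "\<epsilon> > 0" using l by (simp add: \<epsilon>_def m0_def)
  define h where "h z = (a * ln z + b * ln (1 - z)) / 2" for z :: real
  have h0: "h (a / N) = m0"
  proof -
    have "1 - a / N = b / N" using N by (simp add: N_def field_simps)
    then show ?thesis by (simp add: h_def m0_def)
  qed
  have "isCont h (a / N)"
    unfolding h_def using a b by (intro continuous_intros) (auto simp: N_def field_simps)
  then obtain d where d: "d > 0" "\<And>z. \<bar>z - a / N\<bar> < d \<Longrightarrow> \<bar>h z - m0\<bar> < \<epsilon>"
    using \<epsilon> unfolding continuous_at_eps_delta h0 dist_real_def by (metis h0)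
  \<comment> \<open>As \<open>k = N * (A\<^sup>2 - a / N)\<close>, the condition
    \<open>\<bar>k\<bar> < k0\<close> says exactly that \<open>A\<^sup>2\<close> lies within
    \<open>d\<close> of its value on the cone.\<close>
  define k0 where "k0 = N * d"
  have k0: "k0 > 0" using N d by (simp add: k0_def)
  define v where "v = exp (- \<epsilon>)"
  have v: "0 < v" "v < 1" using \<epsilon> by (simp_all add: v_def)
  \<comment> \<open>One entry for each case: away from the cone angle with
    \<open>c \<ge> 1/2\<close>, away from it with \<open>c < 1/2\<close>, and close to it.\<close>
  define \<delta> where "\<delta> = min (min (k0\<^sup>2 / 2) (k0 / 2)) (exp m1 * (1 - v\<^sup>2))"
  have v2: "v\<^sup>2 < 1" using v by (simp add: power_less_one_iff)
  have "\<delta> > 0" using k0 v2 by (simp add: \<delta>_def)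
  moreover
  have "(b * A\<^sup>2 - a * B\<^sup>2)\<^sup>2 * c\<^sup>2 / (2 * (A * B)) + A * B * s\<^sup>2 \<ge> \<delta> * c"
    if A: "A > 0" and B: "B > 0" and AB: "A\<^sup>2 + B\<^sup>2 = 1" and c: "c > 0" and cs: "c\<^sup>2 + s\<^sup>2 = 1"
      and L: "a * ln A + b * ln B + ln c \<le> m1" for A B c s
  proof -
    define k where "k = b * A\<^sup>2 - a * B\<^sup>2"
    define u where "u = A * B"
    have u: "u > 0" using A B by (simp add: u_def)
    have "0 \<le> (A - B)\<^sup>2" by simp
    then have u2: "2 * u \<le> 1" using AB by (simp add: u_def power2_diff)
    have c1: "c \<le> 1"
    proof (rule power2_le_imp_le)
      show "c\<^sup>2 \<le> 1\<^sup>2" using cs zero_le_power2[of s] unfolding power_one by linarith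
    qed simp
    have kz: "k = N * (A\<^sup>2 - a / N)"
    proof -
      have B2: "B\<^sup>2 = 1 - A\<^sup>2" using AB by simp
      have "k = N * A\<^sup>2 - a" unfolding k_def B2 by (simp add: N_def algebra_simps)
      then show ?thesis using N by (simp add: right_diff_distrib)
    qed
    show ?thesis
    proof (cases "\<bar>k\<bar> \<ge> k0")
      case True
      have k2: "k0\<^sup>2 \<le> k\<^sup>2" using True k0 by (metis abs_le_square_iff abs_of_pos)
      have f1: "k0\<^sup>2 * c\<^sup>2 / (2 * u) \<le> k\<^sup>2 * c\<^sup>2 / (2 * u)"
        using k2 u by (intro divide_right_mono mult_right_mono) auto
      show ?thesis
      proof (cases "c \<ge> 1/2")
        case True
        have "\<delta> * c \<le> k0\<^sup>2 / 2 * c" using c by (intro mult_right_mono) (auto simp: \<delta>_def)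
        also have "\<dots> \<le> k0\<^sup>2 * c\<^sup>2"
        proof -
          have "c * (1/2) \<le> c * c" by (rule mult_left_mono) (use True c in auto)
          then have "k0\<^sup>2 * (c * (1/2)) \<le> k0\<^sup>2 * (c * c)" by (rule mult_left_mono) simp
          then show ?thesis by (simp add: power2_eq_square)
        qed
        also have "\<dots> \<le> k0\<^sup>2 * c\<^sup>2 / (2 * u)"
        proof -
          have "k0\<^sup>2 * c\<^sup>2 * (2 * u) \<le> k0\<^sup>2 * c\<^sup>2 * 1" using u2 by (intro mult_left_mono) auto
          then show ?thesis using u by (simp add: pos_le_divide_eq)
        qed
        finally show ?thesis using f1 u by (simp add: k_def u_def add_increasing2)
      next
        case False
        have "c\<^sup>2 \<le> (1/2)\<^sup>2" using False c by (intro power_mono) auto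
        then have s2: "(1/2)\<^sup>2 \<le> s\<^sup>2" using cs by (simp add: power2_eq_square)
        then have s: "1/2 \<le> \<bar>s\<bar>"
          by (metis abs_le_square_iff abs_of_pos half_gt_zero zero_less_one)
        \<comment> \<open>The arithmetic-geometric mean inequality: the factor \<open>u\<close>
          cancels in the product of the two terms, so the bound survives as \<open>u\<close> tends
          to 0.\<close>
        have "0 \<le> (k0 * c - u * \<bar>s\<bar>)\<^sup>2" by simp
        then have "2 * (k0 * c * u * \<bar>s\<bar>) \<le> k0\<^sup>2 * c\<^sup>2 + u\<^sup>2 * s\<^sup>2"
          by (simp add: power2_diff power_mult_distrib mult_ac)
        also have "\<dots> \<le> k0\<^sup>2 * c\<^sup>2 + 2 * (u\<^sup>2 * s\<^sup>2)" by simp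
        finally have "k0 * c * \<bar>s\<bar> \<le> k0\<^sup>2 * c\<^sup>2 / (2 * u) + u * s\<^sup>2"
          using u by (simp add: field_simps power2_eq_square)
        moreover have "\<delta> * c \<le> k0 * c * \<bar>s\<bar>"
        proof -
          have "\<delta> * c \<le> (k0 / 2) * c" using c by (intro mult_right_mono) (auto simp: \<delta>_def)
          also have "\<dots> = k0 * c * (1/2)" by simp
          also have "\<dots> \<le> k0 * c * \<bar>s\<bar>" using s k0 c by (intro mult_left_mono) auto
          finally show ?thesis .
        qed
        ultimately show ?thesis using f1 by (simp add: k_def u_def)
      qed
    next
      case False
      then have "\<bar>A\<^sup>2 - a / N\<bar> < d" using N by (simp add: kz k0_def abs_mult)
      then have hz: "h (A\<^sup>2) > m0 - \<epsilon>" using d(2)[of "A\<^sup>2"] by linarith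
      have hA: "h (A\<^sup>2) = a * ln A + b * ln B"
      proof -
        have "1 - A\<^sup>2 = B\<^sup>2" using AB by simp
        then show ?thesis using A B by (simp add: h_def ln_realpow)
      qed
      \<comment> \<open>Near the cone angle the deficit must come from \<open>c\<close>; hence the
        tangent is tilted away from the radial direction and \<open>s\<close> is bounded away from
        0.\<close>
      have "ln c \<le> - \<epsilon>" using L hA hz by (simp add: \<epsilon>_def field_simps)
      then have "c \<le> v" using c by (metis exp_le_cancel_iff exp_ln v_def)
      then have cv: "c\<^sup>2 \<le> v\<^sup>2" using c by (intro power_mono) auto
      have AB1: "A \<le> 1" "B \<le> 1"
      proof -
        have "A\<^sup>2 \<le> 1\<^sup>2" "B\<^sup>2 \<le> 1\<^sup>2" using AB zero_le_power2[of A] zero_le_power2[of B] unfolding power_one by linarith+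
        then show "A \<le> 1" "B \<le> 1" by (auto intro: power2_le_imp_le)
      qed
      \<comment> \<open>The logarithms are nonpositive, so weights of at least 1 only decrease them;
        this keeps \<open>A * B\<close> away from 0.\<close>
      have "a * ln A \<le> 1 * ln A" "b * ln B \<le> 1 * ln B"
        using AB1 A B a b by (intro mult_right_mono_neg; simp)+
      then have "ln u \<ge> m1"
        using hz hA \<epsilon> A B by (simp add: u_def ln_mult \<epsilon>_def field_simps)
      then have ul: "exp m1 \<le> u" using u by (metis exp_le_cancel_iff exp_ln)
      have "\<delta> * c \<le> \<delta> * 1" using c1 \<open>\<delta> > 0\<close> by (intro mult_left_mono) auto
      also have "\<dots> \<le> exp m1 * (1 - v\<^sup>2)" by (simp add: \<delta>_def)
      also have "\<dots> \<le> u * s\<^sup>2"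
        using ul cv cs v2 u by (intro mult_mono) (auto simp: algebra_simps)
      finally show ?thesis using u unfolding u_def k_def
        by (simp add: add_increasing)
    qed
  qed
  ultimately show thesis using that by blast
qed

lemma unit_le_1: "u\<^sup>2 + v\<^sup>2 = 1 \<Longrightarrow> u \<le> 1 \<and> \<bar>v\<bar> \<le> (1::real)"
proof -
  assume "u\<^sup>2 + v\<^sup>2 = 1"
  then have "u\<^sup>2 \<le> 1" "v\<^sup>2 \<le> 1" using zero_le_power2[of u] zero_le_power2[of v] by linarith+
  then show ?thesis by (auto simp: abs_square_le_1)
qed

section \<open>A branch leaving the origin\<close>

text \<open>The minimality equation is solved for the acceleration: at unit speed this is the
  curvature times the unit normal \<open>(- Y, X)\<close>. A branch that runs into the origin is
  brought to this form by reversing time.\<close>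

locale minimal_branch =
  fixes a b t0 :: real and x y X Y :: "real \<Rightarrow> real"
  assumes a: "a \<ge> 1" and b: "b \<ge> 1"
    and x_deriv: "\<And>t. t > t0 \<Longrightarrow> (x has_real_derivative X t) (at t)"
    and y_deriv: "\<And>t. t > t0 \<Longrightarrow> (y has_real_derivative Y t) (at t)"
    and X_deriv: "\<And>t. t > t0 \<Longrightarrow>
      (X has_real_derivative - Y t * (b * X t / y t - a * Y t / x t)) (at t)"
    and Y_deriv: "\<And>t. t > t0 \<Longrightarrow>
      (Y has_real_derivative X t * (b * X t / y t - a * Y t / x t)) (at t)"
    and unit: "\<And>t. t > t0 \<Longrightarrow> (X t)\<^sup>2 + (Y t)\<^sup>2 = 1"
    and x_pos: "\<And>t. t > t0 \<Longrightarrow> x t > 0"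
    and y_pos: "\<And>t. t > t0 \<Longrightarrow> y t > 0"
    and x_lim: "(x \<longlongrightarrow> 0) (at_right t0)"
    and y_lim: "(y \<longlongrightarrow> 0) (at_right t0)"
begin

definition r where "r t = sqrt ((x t)\<^sup>2 + (y t)\<^sup>2)"
text \<open>\<open>P\<close> and \<open>Q\<close> are the inner product and the determinant of
  position and tangent, that is, r cos \<psi> and r sin \<psi>.\<close>

definition P where "P t = x t * X t + y t * Y t"
definition Q where "Q t = x t * Y t - y t * X t"
definition \<kappa> where "\<kappa> t = b * X t / y t - a * Y t / x t"

lemma r_pos: "t > t0 \<Longrightarrow> r t > 0"
  using x_pos[of t] unfolding r_def by (simp add: add_pos_nonneg)

lemma r2: "(r t)\<^sup>2 = (x t)\<^sup>2 + (y t)\<^sup>2"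
  unfolding r_def by simp

lemma PQ: "t > t0 \<Longrightarrow> (P t)\<^sup>2 + (Q t)\<^sup>2 = (r t)\<^sup>2"
proof -
  assume t: "t > t0"
  have "(P t)\<^sup>2 + (Q t)\<^sup>2 = ((x t)\<^sup>2 + (y t)\<^sup>2) * ((X t)\<^sup>2 + (Y t)\<^sup>2)"
    unfolding P_def Q_def by algebra
  then show ?thesis using unit[OF t] r2 by simp
qed

lemma r_lim: "(r \<longlongrightarrow> 0) (at_right t0)"
proof -
  have "((\<lambda>t. sqrt ((x t)\<^sup>2 + (y t)\<^sup>2)) \<longlongrightarrow> sqrt (0\<^sup>2 + 0\<^sup>2)) (at_right t0)"
    by (intro tendsto_intros x_lim y_lim)
  then show ?thesis unfolding r_def[abs_def] by simp
qed

lemma r_deriv: "t > t0 \<Longrightarrow> (r has_real_derivative P t / r t) (at t)"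
proof -
  assume t: "t > t0"
  have "(r has_real_derivative 2 * (x t * X t + y t * Y t) / (2 * r t)) (at t)"
    using r_pos[OF t] t unfolding r_def[abs_def]
    by (auto intro!: derivative_eq_intros x_deriv y_deriv simp: field_simps)
  then show ?thesis unfolding P_def
    by (simp only: mult_divide_mult_cancel_left_if) simp
qed

lemma P_deriv: "t > t0 \<Longrightarrow> (P has_real_derivative 1 - \<kappa> t * Q t) (at t)"
proof -
  assume t: "t > t0"
  have "(P has_real_derivative X t * X t + x t * (- Y t * \<kappa> t) + (Y t * Y t + y t * (X t * \<kappa> t))) (at t)"
    unfolding P_def[abs_def] \<kappa>_def using t
    by (auto intro!: derivative_eq_intros x_deriv y_deriv X_deriv Y_deriv simp: algebra_simps)
  moreover have "X t * X t + Y t * Y t = 1" using unit[OF t] by (simp add: power2_eq_square)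
  ultimately show ?thesis unfolding Q_def
    by (elim DERIV_cong) (simp add: algebra_simps)
qed

lemma Q_deriv: "t > t0 \<Longrightarrow> (Q has_real_derivative \<kappa> t * P t) (at t)"
proof -
  assume t: "t > t0"
  have "(Q has_real_derivative X t * Y t + x t * (X t * \<kappa> t) - (Y t * X t + y t * (- Y t * \<kappa> t))) (at t)"
    unfolding Q_def[abs_def] \<kappa>_def using t
    by (auto intro!: derivative_eq_intros x_deriv y_deriv X_deriv Y_deriv simp: algebra_simps)
  then show ?thesis unfolding P_def
    by (elim DERIV_cong) (simp add: algebra_simps)
qed

text \<open>For integer weights, \<open>w\<close> is the volume of an orbit up to a constant, and M'
  = (a + b + 1) w is the reduced form of a general fact: along a minimal hypersurface the tangential
  divergence of the position field equals the dimension.\<close>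

lemma P_pos: assumes "t > t0" shows "P t > 0"
proof -
  define w where "w t = exp (a * ln (x t) + b * ln (y t))" for t
  define M where "M t = w t * P t" for t
  have M_deriv: "(M has_real_derivative (a + b + 1) * w t) (at t)" if t: "t > t0" for t
  proof -
    have "(w has_real_derivative w t * (a * (X t / x t) + b * (Y t / y t))) (at t)"
      unfolding w_def[abs_def] using t x_pos y_pos
      by (auto intro!: derivative_eq_intros x_deriv y_deriv simp: mult_ac)
    then have "(M has_real_derivative
        w t * (a * (X t / x t) + b * (Y t / y t)) * P t + (1 - \<kappa> t * Q t) * w t) (at t)"
      unfolding M_def[abs_def] using P_deriv[OF t] by (rule DERIV_mult)
    moreover have "(a * (X t / x t) + b * (Y t / y t)) * P t - \<kappa> t * Q t
        = (a + b) * ((X t)\<^sup>2 + (Y t)\<^sup>2)"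
      using x_pos[OF t] y_pos[OF t] unfolding P_def Q_def \<kappa>_def
      by (simp add: divide_simps) algebra
    then have "(a * (X t / x t) + b * (Y t / y t)) * P t - \<kappa> t * Q t = a + b"
      using unit[OF t] by simp
    then have "w t * (a * (X t / x t) + b * (Y t / y t)) * P t + (1 - \<kappa> t * Q t) * w t
        = (a + b + 1) * w t" by algebra
    ultimately show ?thesis by simp
  qed
  have mono: "M u < M v" if "t0 < u" "u < v" for u v
  proof (rule DERIV_pos_imp_increasing[OF that(2)])
    fix z assume "u \<le> z" "z \<le> v"
    then show "\<exists>D. (M has_real_derivative D) (at z) \<and> D > 0"
      using M_deriv[of z] that a b by (intro exI[of _ "(a + b + 1) * w z"]) (auto simp: w_def)
  qed
  \<comment> \<open>The limit at \<open>t0\<close> yields only a weak inequality. It is taken at an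
    intermediate point, and strict growth from there to \<open>t\<close> restores
    strictness.\<close>
  define m where "m = (t0 + t) / 2"
  have "(M \<longlongrightarrow> 0) (at_right t0)"
  proof (rule Lim_null_comparison[OF _ r_lim])
    have "\<forall>\<^sub>F t in at_right t0. x t < 1" "\<forall>\<^sub>F t in at_right t0. y t < 1"
      using order_tendstoD(2)[OF x_lim, of 1] order_tendstoD(2)[OF y_lim, of 1] by simp_all
    moreover have "\<forall>\<^sub>F t in at_right t0. t > t0"
      by (simp add: eventually_at_right_less)
    ultimately show "\<forall>\<^sub>F t in at_right t0. norm (M t) \<le> r t"
    proof eventually_elim
      case (elim t)
      have "a * ln (x t) + b * ln (y t) \<le> 0"
        using elim x_pos y_pos a b by (intro add_nonpos_nonpos mult_nonneg_nonpos) (auto simp: less_imp_le)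
      then have "w t \<le> 1" by (simp add: w_def)
      have "(P t)\<^sup>2 \<le> (r t)\<^sup>2" using PQ[OF elim(3)] by (simp flip: PQ[OF elim(3)])
      then have "\<bar>P t\<bar> \<le> r t" using r_pos[OF elim(3)] by (metis abs_le_square_iff abs_of_pos)
      then have "w t * \<bar>P t\<bar> \<le> 1 * r t" using \<open>w t \<le> 1\<close> by (intro mult_mono) auto
      then show ?case by (simp add: M_def abs_mult w_def)
    qed
  qed
  then have "M m \<ge> 0"
  proof (rule tendsto_upperbound)
    have "\<forall>\<^sub>F u in at_right t0. u \<in> {t0<..<m}"
      using assms by (intro eventually_at_rightI[of _ m]) (auto simp: m_def)
    then show "\<forall>\<^sub>F u in at_right t0. M u \<le> M m"
      by eventually_elim (auto intro: less_imp_le mono)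
  qed simp
  also have "M m < M t" using assms by (intro mono) (auto simp: m_def)
  finally show ?thesis by (simp add: M_def w_def zero_less_mult_iff)
qed

section \<open>The polar system\<close>

text \<open>
  \<open>(A, B) = (cos \<theta>, sin \<theta>)\<close> and \<open>(c, s) = (cos \<psi>, sin \<psi>)\<close>; below, \<open>\<omega> = r \<psi>'\<close>, \<open>L = ln F\<close>.
\<close>

definition A where "A t = x t / r t"
definition B where "B t = y t / r t"
definition c where "c t = P t / r t"
definition s where "s t = Q t / r t"

lemma A_pos: "t > t0 \<Longrightarrow> A t > 0" and B_pos: "t > t0 \<Longrightarrow> B t > 0" and c_pos: "t > t0 \<Longrightarrow> c t > 0"
  using x_pos y_pos P_pos r_pos by (auto simp: A_def B_def c_def)

lemma AB_unit: "t > t0 \<Longrightarrow> (A t)\<^sup>2 + (B t)\<^sup>2 = 1"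
  using r_pos[of t] r2[of t, symmetric] by (simp add: A_def B_def power_divide flip: add_divide_distrib)

lemma cs_unit: "t > t0 \<Longrightarrow> (c t)\<^sup>2 + (s t)\<^sup>2 = 1"
  using r_pos[of t] PQ[of t] by (simp add: c_def s_def power_divide flip: add_divide_distrib)

lemma r_deriv': "t > t0 \<Longrightarrow> (r has_real_derivative c t) (at t)"
  using r_deriv by (simp add: c_def)

lemma A_deriv: "t > t0 \<Longrightarrow> (A has_real_derivative - B t * s t / r t) (at t)"
proof -
  assume t: "t > t0"
  note rp = r_pos[OF t]
  have "(A has_real_derivative (X t * r t - x t * (P t / r t)) / (r t * r t)) (at t)"
    unfolding A_def[abs_def] using rp by (intro DERIV_divide x_deriv r_deriv t) auto
  moreover have "X t * r t - x t * (P t / r t) = (X t * (r t)\<^sup>2 - x t * P t) / r t"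
    using rp by (simp add: field_simps power2_eq_square)
  moreover have "X t * (r t)\<^sup>2 - x t * P t = - y t * Q t"
    unfolding r2 P_def Q_def by algebra
  ultimately show ?thesis by (simp add: B_def s_def mult_ac)
qed

lemma B_deriv: "t > t0 \<Longrightarrow> (B has_real_derivative A t * s t / r t) (at t)"
proof -
  assume t: "t > t0"
  note rp = r_pos[OF t]
  have "(B has_real_derivative (Y t * r t - y t * (P t / r t)) / (r t * r t)) (at t)"
    unfolding B_def[abs_def] using rp by (intro DERIV_divide y_deriv r_deriv t) auto
  moreover have "Y t * r t - y t * (P t / r t) = (Y t * (r t)\<^sup>2 - y t * P t) / r t"
    using rp by (simp add: field_simps power2_eq_square)
  moreover have "Y t * (r t)\<^sup>2 - y t * P t = x t * Q t"
    unfolding r2 P_def Q_def by algebra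
  ultimately show ?thesis by (simp add: A_def s_def mult_ac)
qed

text \<open>\<open>k / (A * B)\<close> is b cot \<theta> - a tan \<theta>, so \<open>k\<close>
  vanishes exactly at the angle of the cone.\<close>

definition k where "k t = b * (A t)\<^sup>2 - a * (B t)\<^sup>2"

definition \<omega> where "\<omega> t = c t * k t / (A t * B t) - (a + b + 1) * s t"

text \<open>The tangent makes the angle \<theta> + \<psi> with the first axis, so the curvature is
  \<theta>' + \<psi>'. Multiplied by \<open>r\<close>, the two summands become \<open>s\<close> and
  \<omega>.\<close>

lemma \<kappa>_eq: assumes t: "t > t0" shows "\<kappa> t * r t = \<omega> t + s t"
proof -
  note pos = r_pos[OF t] x_pos[OF t] y_pos[OF t]
  \<comment> \<open>The tangent is expanded in the radial and angular directions.\<close>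
  have 1: "X t * (r t)\<^sup>2 = x t * P t - y t * Q t" "Y t * (r t)\<^sup>2 = y t * P t + x t * Q t"
    unfolding r2 P_def Q_def by algebra+
  have "\<kappa> t * (x t * y t) * (r t)\<^sup>2 = b * x t * (X t * (r t)\<^sup>2) - a * y t * (Y t * (r t)\<^sup>2)"
    using pos by (simp add: \<kappa>_def field_simps)
  also have "\<dots> = (b * (x t)\<^sup>2 - a * (y t)\<^sup>2) * P t - (a + b) * (x t * y t) * Q t"
    unfolding 1 by algebra
  finally show ?thesis using pos
    unfolding \<omega>_def c_def s_def k_def A_def B_def
    by (simp add: divide_simps power2_eq_square) algebra
qed

lemma c_deriv: "t > t0 \<Longrightarrow> (c has_real_derivative - s t * \<omega> t / r t) (at t)"
proof -
  assume t: "t > t0"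
  note rp = r_pos[OF t]
  have "(c has_real_derivative ((1 - \<kappa> t * Q t) * r t - P t * (P t / r t)) / (r t * r t)) (at t)"
    unfolding c_def[abs_def] using rp by (intro DERIV_divide P_deriv r_deriv t) auto
  moreover have "((1 - \<kappa> t * Q t) * r t - P t * (P t / r t)) / (r t * r t) = - s t * \<omega> t / r t"
  proof -
    have w: "\<omega> t = \<kappa> t * r t - s t" using \<kappa>_eq[OF t] by simp
    have "(P t)\<^sup>2 = (r t)\<^sup>2 - (Q t)\<^sup>2" using PQ[OF t] by simp
    then show ?thesis using rp unfolding w s_def
      by (simp add: divide_simps power2_eq_square) (simp add: algebra_simps)
  qed
  ultimately show ?thesis by simp
qed

lemma s_deriv: "t > t0 \<Longrightarrow> (s has_real_derivative c t * \<omega> t / r t) (at t)"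
proof -
  assume t: "t > t0"
  note rp = r_pos[OF t]
  have "(s has_real_derivative (\<kappa> t * P t * r t - Q t * (P t / r t)) / (r t * r t)) (at t)"
    unfolding s_def[abs_def] using rp by (intro DERIV_divide Q_deriv r_deriv t) auto
  moreover have "(\<kappa> t * P t * r t - Q t * (P t / r t)) / (r t * r t) = c t * \<omega> t / r t"
  proof -
    have w: "\<omega> t = \<kappa> t * r t - s t" using \<kappa>_eq[OF t] by simp
    show ?thesis using rp unfolding w s_def c_def
      by (simp add: divide_simps power2_eq_square) algebra
  qed
  ultimately show ?thesis by simp
qed

section \<open>The density and the Lyapunov function\<close>

definition L where "L t = a * ln (A t) + b * ln (B t) + ln (c t)"

text \<open>The angular logarithms contribute \<open>k * s / (A * B * r)\<close>, which cancels the
  part of (ln c)' that contains \<open>k\<close>. What remains is the damping term of \<omega>, and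
  it has a sign.\<close>

lemma L_deriv: "t > t0 \<Longrightarrow> (L has_real_derivative (a + b + 1) * (s t)\<^sup>2 / (c t * r t)) (at t)"
proof -
  assume t: "t > t0"
  note pos = r_pos[OF t] A_pos[OF t] B_pos[OF t] c_pos[OF t]
  have "(L has_real_derivative a * ((- B t * s t / r t) / A t) + b * ((A t * s t / r t) / B t)
      + (- s t * \<omega> t / r t) / c t) (at t)"
    unfolding L_def[abs_def] using pos t
    by (auto intro!: derivative_eq_intros A_deriv B_deriv c_deriv simp: mult_ac)
  moreover have "a * ((- B t * s t / r t) / A t) + b * ((A t * s t / r t) / B t)
      + (- s t * \<omega> t / r t) / c t = (a + b + 1) * (s t)\<^sup>2 / (c t * r t)"
    using pos unfolding \<omega>_def k_def
    by (simp add: divide_simps power2_eq_square) algebra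
  ultimately show ?thesis by simp
qed

lemma L_mono: assumes "t0 < u" "u \<le> v" shows "L u \<le> L v"
proof (rule DERIV_nonneg_imp_nondecreasing[OF assms(2)])
  fix z assume "u \<le> z" "z \<le> v"
  then have z: "z > t0" using assms by simp
  show "\<exists>D. (L has_real_derivative D) (at z) \<and> D \<ge> 0"
    using L_deriv[OF z] c_pos[OF z] r_pos[OF z] a b by force
qed

lemma k_deriv: "t > t0 \<Longrightarrow> (k has_real_derivative - 2 * (a + b) * (A t * B t) * s t / r t) (at t)"
proof -
  assume t: "t > t0"
  have "(k has_real_derivative b * (2 * A t * (- B t * s t / r t)) - a * (2 * B t * (A t * s t / r t))) (at t)"
    unfolding k_def[abs_def] using t
    by (auto intro!: derivative_eq_intros A_deriv B_deriv simp: mult_ac)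
  then show ?thesis
    by (elim DERIV_cong) (use r_pos[OF t] in \<open>simp add: field_simps\<close>)
qed

text \<open>
  The exponent \<open>1/(a + b)\<close> on \<open>F = exp L\<close> makes the first summand dominate \<open>A B c\<close>, so that its
  derivative absorbs the negative terms of \<open>(k s)'\<close>, which are of order \<open>A B s\<^sup>2\<close>, uniformly up to
  the coordinate axes.
\<close>

definition H where
  "H t = (2 * (a + b) + (a + b + 1)\<^sup>2 / 2 + 1) * exp (L t / (a + b)) + k t * s t"

lemma H_deriv:
  assumes t: "t > t0"
  obtains D where "(H has_real_derivative D / r t) (at t)"
    and "D \<ge> (k t)\<^sup>2 * (c t)\<^sup>2 / (2 * (A t * B t)) + A t * B t * (s t)\<^sup>2"
proof -
  note pos = r_pos[OF t] A_pos[OF t] B_pos[OF t] c_pos[OF t]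
  define N where "N = a + b"
  have N: "N \<ge> 2" using a b by (simp add: N_def)
  \<comment> \<open>\<open>2 * N\<close> pays for the derivative of \<open>k\<close> in
    \<open>k * s\<close>, \<open>(N + 1)\<^sup>2 / 2\<close> for the square completed below, and the
    final 1 leaves \<open>A * B * s\<^sup>2\<close> over.\<close>
  define K where "K = 2 * N + (N + 1)\<^sup>2 / 2 + 1"
  have K: "K \<ge> 0" using N by (simp add: K_def)
  define u where "u = A t * B t"
  have u: "u > 0" using pos by (simp add: u_def)
  define \<Phi> where "\<Phi> = exp (L t / N)"
  define D where "D = K * (\<Phi> * ((N + 1) * (s t)\<^sup>2 / (c t * N)))
    + (- 2 * N * u * (s t)\<^sup>2 + k t * c t * \<omega> t)"
  have "(H has_real_derivative K * (\<Phi> * ((N + 1) * (s t)\<^sup>2 / (c t * r t) / N))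
    + ((- 2 * N * u * s t / r t) * s t + (c t * \<omega> t / r t) * k t)) (at t)"
    unfolding H_def[abs_def] K_def \<Phi>_def N_def u_def using pos t a b
    by (intro derivative_intros DERIV_add DERIV_mult DERIV_cmult DERIV_fun_exp DERIV_cdivide
        L_deriv k_deriv s_deriv DERIV_cong[OF DERIV_fun_exp]) auto
  then have 1: "(H has_real_derivative D / r t) (at t)"
    by (elim DERIV_cong) (use pos N in \<open>simp add: D_def field_simps power2_eq_square\<close>)
  \<comment> \<open>In \<Phi> the numbers \<open>A\<close>, \<open>B\<close> and \<open>c\<close>,
    all at most 1, carry the exponents \<open>a / N\<close>, \<open>b / N\<close> and
    \<open>1 / N\<close>, also at most 1.\<close>
  have "\<Phi> \<ge> u * c t"
  proof -
    have le1: "A t \<le> 1" "B t \<le> 1" "c t \<le> 1"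
      using unit_le_1 AB_unit[OF t] cs_unit[OF t] pos by (force simp: add.commute)+
    have "N * ln (A t) \<le> a * ln (A t)" "N * ln (B t) \<le> b * ln (B t)" "N * ln (c t) \<le> 1 * ln (c t)"
      using le1 pos a b N unfolding N_def by (intro mult_right_mono_neg; simp)+
    then have "N * (ln (A t) + ln (B t) + ln (c t)) \<le> L t" by (simp add: L_def algebra_simps)
    then have "ln (u * c t) \<le> L t / N"
      using pos N by (simp add: u_def ln_mult field_simps)
    then show ?thesis unfolding \<Phi>_def using u pos by (metis exp_le_cancel_iff exp_ln mult_pos_pos)
  qed
  then have "u * c t * ((N + 1) * (s t)\<^sup>2 / (c t * N)) \<le> \<Phi> * ((N + 1) * (s t)\<^sup>2 / (c t * N))"
    using N pos by (intro mult_right_mono) auto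
  \<comment> \<open>The factor \<open>c\<close> lost in the estimate of \<Phi> cancels the
    \<open>c\<close> in the denominator of the derivative of \<open>L\<close>.\<close>
  moreover have "u * (s t)\<^sup>2 \<le> u * c t * ((N + 1) * (s t)\<^sup>2 / (c t * N))"
  proof -
    have "u * (s t)\<^sup>2 * 1 \<le> u * (s t)\<^sup>2 * ((N + 1) / N)"
      using N u by (intro mult_left_mono) auto
    then show ?thesis using pos by (simp add: mult_ac)
  qed
  ultimately have "K * (u * (s t)\<^sup>2) \<le> K * (\<Phi> * ((N + 1) * (s t)\<^sup>2 / (c t * N)))"
    using K by (intro mult_left_mono) auto
  moreover have "k t * c t * \<omega> t \<ge> (k t)\<^sup>2 * (c t)\<^sup>2 / (2 * u) - (N + 1)\<^sup>2 / 2 * (u * (s t)\<^sup>2)"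
  proof -
    \<comment> \<open>Completing the square absorbs the mixed term
      \<open>(N + 1) * k * c * s\<close> at the cost of half of
      \<open>k\<^sup>2 * c\<^sup>2 / u\<close>.\<close>
    have "0 \<le> (k t * c t - (N + 1) * u * s t)\<^sup>2 / (2 * u)" using u by simp
    also have "\<dots> = k t * c t * \<omega> t - ((k t)\<^sup>2 * (c t)\<^sup>2 / (2 * u) - (N + 1)\<^sup>2 / 2 * (u * (s t)\<^sup>2))"
      using u unfolding \<omega>_def u_def[symmetric] N_def[symmetric]
      by (simp add: field_simps power2_eq_square)
    finally show ?thesis by simp
  qed
  ultimately have 2: "D \<ge> (k t)\<^sup>2 * (c t)\<^sup>2 / (2 * u) + u * (s t)\<^sup>2"
    unfolding D_def K_def by (simp add: algebra_simps)
  show thesis using that 1 2 unfolding u_def by blast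
qed

lemma H_lower: assumes t: "t > t0" shows "H t \<ge> - (a + b)"
proof -
  have "\<bar>s t\<bar> \<le> 1" using unit_le_1 cs_unit[OF t] by blast
  moreover have "\<bar>k t\<bar> \<le> a + b"
  proof -
    have "(A t)\<^sup>2 \<le> 1" "(B t)\<^sup>2 \<le> 1"
      using AB_unit[OF t] zero_le_power2[of "A t"] zero_le_power2[of "B t"] by linarith+
    then have "b * (A t)\<^sup>2 \<le> b * 1" "a * (B t)\<^sup>2 \<le> a * 1" using a b by (intro mult_left_mono; simp)+
    moreover have "b * (A t)\<^sup>2 \<ge> 0" "a * (B t)\<^sup>2 \<ge> 0" using a b by simp_all
    ultimately show ?thesis using a b unfolding k_def by linarith
  qed
  ultimately have "\<bar>k t\<bar> * \<bar>s t\<bar> \<le> (a + b) * 1" by (intro mult_mono) auto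
  then have "k t * s t \<ge> - (a + b)" by (simp flip: abs_mult)
  moreover have "(2 * (a + b) + (a + b + 1)\<^sup>2 / 2 + 1) * exp (L t / (a + b)) \<ge> 0"
    using a b by simp
  ultimately show ?thesis unfolding H_def by linarith
qed

section \<open>Rigidity of the branch\<close>

lemma L_ge: assumes t: "t > t0"
  shows "L t \<ge> (a * ln (a / (a + b)) + b * ln (b / (a + b))) / 2"
proof (rule ccontr)
  assume "\<not> ?thesis"
  then have l: "L t < (a * ln (a / (a + b)) + b * ln (b / (a + b))) / 2" by simp
  obtain \<delta> where \<delta>: "\<delta> > 0"
    and rate: "\<And>A B c s. \<lbrakk>A > 0; B > 0; A\<^sup>2 + B\<^sup>2 = 1; c > 0; c\<^sup>2 + s\<^sup>2 = 1; a * ln A + b * ln B + ln c \<le> L t\<rbrakk>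
      \<Longrightarrow> (b * A\<^sup>2 - a * B\<^sup>2)\<^sup>2 * c\<^sup>2 / (2 * (A * B)) + A * B * s\<^sup>2 \<ge> \<delta> * c"
    using lyapunov_rate_bound[OF a b l] by blast
  \<comment> \<open>Since \<open>L\<close> is nondecreasing, the level \<open>L t\<close> bounds it
    on all of the branch before \<open>t\<close>, so a single \<delta> serves down to the
    origin.\<close>
  have key: "H u - \<delta> * ln (r u) \<le> H t - \<delta> * ln (r t)" if u: "t0 < u" "u \<le> t" for u
  proof (rule DERIV_nonneg_imp_nondecreasing[OF u(2)])
    fix z assume z: "u \<le> z" "z \<le> t"
    then have z0: "z > t0" using u by simp
    obtain D where D: "(H has_real_derivative D / r z) (at z)"
      "D \<ge> (k z)\<^sup>2 * (c z)\<^sup>2 / (2 * (A z * B z)) + A z * B z * (s z)\<^sup>2"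
      using H_deriv[OF z0] by blast
    have "\<delta> * c z \<le> (k z)\<^sup>2 * (c z)\<^sup>2 / (2 * (A z * B z)) + A z * B z * (s z)\<^sup>2"
      unfolding k_def using L_mono[OF z0 z(2)]
      by (intro rate A_pos B_pos c_pos AB_unit cs_unit z0) (simp add: L_def)
    then have ge: "D - \<delta> * c z \<ge> 0" using D(2) by simp
    have "((\<lambda>u. H u - \<delta> * ln (r u)) has_real_derivative D / r z - \<delta> * (c z / r z)) (at z)"
      using D(1) r_deriv'[OF z0] r_pos[OF z0]
      by (auto intro!: derivative_eq_intros)
    moreover have "D / r z - \<delta> * (c z / r z) \<ge> 0"
      using ge r_pos[OF z0] by (simp flip: diff_divide_distrib)
    ultimately show "\<exists>D. ((\<lambda>u. H u - \<delta> * ln (r u)) has_real_derivative D) (at z) \<and> D \<ge> 0" by blast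
  qed
  \<comment> \<open>The lower bound for \<open>ln r\<close> that results from putting
    \<open>H u \<ge> - (a + b)\<close> into \<open>key\<close>.\<close>
  define m where "m = (- (a + b) - H t + \<delta> * ln (r t)) / \<delta>"
  have low: "m \<le> ln (r u)" if u: "t0 < u" "u \<le> t" for u
    using key[OF u] H_lower[OF u(1)] \<delta> unfolding m_def by (simp add: field_simps)
  have "\<forall>\<^sub>F u in at_right t0. r u < exp m"
    using order_tendstoD(2)[OF r_lim, of "exp m"] by simp
  moreover have "\<forall>\<^sub>F u in at_right t0. u \<in> {t0<..<t}"
    using t by (intro eventually_at_rightI[of _ t]) auto
  ultimately have "\<forall>\<^sub>F u in at_right t0. False"
  proof eventually_elim
    case (elim u)
    then have "exp m \<le> r u" using low[of u] r_pos[of u] by (simp add: ln_ge_iff)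
    then show ?case using elim by simp
  qed
  then show False by simp
qed

text \<open>\<open>L\<close> is at least the maximum of its angular part, while
  \<open>ln c \<le> 0\<close>. So both are equalities: the angle is that of the cone, and
  \<open>c = 1\<close> means r' = 1.\<close>

lemma on_cone: assumes t: "t > t0"
  shows "b * (x t)\<^sup>2 = a * (y t)\<^sup>2" and "r t = t - t0"
proof -
  have *: "c t = 1 \<and> b * (A t)\<^sup>2 = a * (B t)\<^sup>2" if t: "t > t0" for t
  proof -
    have c1: "c t \<le> 1" using unit_le_1 cs_unit[OF t] by blast
    have ab: "a > 0" "b > 0" using a b by simp_all
    note le = weighted_log_bound[OF ab A_pos[OF t] B_pos[OF t] AB_unit[OF t]]
    have lc: "ln (c t) \<le> 0" using c1 c_pos[OF t] by simp
    have "ln (c t) = 0" using le(1) L_ge[OF t] lc unfolding L_def by linarith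
    moreover have "a * ln (A t) + b * ln (B t) = (a * ln (a / (a + b)) + b * ln (b / (a + b))) / 2"
      using le(1) L_ge[OF t] lc unfolding L_def by linarith
    ultimately show ?thesis using le(2) c_pos[OF t] by simp
  qed
  show "b * (x t)\<^sup>2 = a * (y t)\<^sup>2"
    using *[OF t] r_pos[OF t] by (simp add: A_def B_def power_divide)
  \<comment> \<open>The constant value of \<open>r u - u\<close> is then read off from its limit at
    \<open>t0\<close>, where \<open>r\<close> vanishes.\<close>
  have const: "r u - u = r t - t" if u: "t0 < u" "u \<le> t" for u
  proof (cases "u = t")
    case False
    then have "u < t" using u by simp
    then have "\<exists>z>u. z < t \<and> (r t - t) - (r u - u) = (t - u) * 0"
    proof (rule MVT2)
      fix z assume "u \<le> z" "z \<le> t"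
      then show "((\<lambda>u. r u - u) has_real_derivative 0) (at z)"
        using u r_deriv'[of z] *[of z] by (auto intro!: derivative_eq_intros)
    qed
    then show ?thesis by auto
  qed simp
  have "((\<lambda>u. r u - u) \<longlongrightarrow> 0 - t0) (at_right t0)"
    by (intro tendsto_intros r_lim)
  moreover have "((\<lambda>u. r u - u) \<longlongrightarrow> r t - t) (at_right t0)"
  proof (rule tendsto_eventually)
    have "\<forall>\<^sub>F u in at_right t0. u \<in> {t0<..<t}"
      using t by (intro eventually_at_rightI[of _ t]) auto
    then show "\<forall>\<^sub>F u in at_right t0. r u - u = r t - t"
      by eventually_elim (auto intro: const)
  qed
  ultimately have "0 - t0 = r t - t" by (rule tendsto_unique[rotated]) simp
  then show "r t = t - t0" by simp
qed

end

section \<open>From cusp profiles to branches\<close>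

text \<open>Differentiating the unit speed condition makes the acceleration orthogonal to the
  tangent, so it is determined by its normal component, which the minimality equation
  prescribes.\<close>

lemma minimal_branchI:
  fixes x y X Y X' Y' :: "real \<Rightarrow> real"
  assumes "a \<ge> 1" "b \<ge> 1"
    and x: "\<And>t. t > t0 \<Longrightarrow> (x has_real_derivative X t) (at t)"
    and y: "\<And>t. t > t0 \<Longrightarrow> (y has_real_derivative Y t) (at t)"
    and X: "\<And>t. t > t0 \<Longrightarrow> (X has_real_derivative X' t) (at t)"
    and Y: "\<And>t. t > t0 \<Longrightarrow> (Y has_real_derivative Y' t) (at t)"
    and unit: "\<And>t. t > t0 \<Longrightarrow> (X t)\<^sup>2 + (Y t)\<^sup>2 = 1"
    and pos: "\<And>t. t > t0 \<Longrightarrow> x t > 0" "\<And>t. t > t0 \<Longrightarrow> y t > 0"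
    and min: "\<And>t. t > t0 \<Longrightarrow> X t * Y' t - X' t * Y t + a * (Y t / x t) - b * (X t / y t) = 0"
    and lim: "(x \<longlongrightarrow> 0) (at_right t0)" "(y \<longlongrightarrow> 0) (at_right t0)"
  shows "minimal_branch a b t0 x y X Y"
proof
  fix t assume t: "t > t0"
  have "((\<lambda>t. (X t)\<^sup>2 + (Y t)\<^sup>2) has_real_derivative 2 * X t * X' t + 2 * Y t * Y' t) (at t)"
    using t by (auto intro!: derivative_eq_intros X Y)
  moreover have "((\<lambda>t. (X t)\<^sup>2 + (Y t)\<^sup>2) has_real_derivative 0) (at t)"
    by (rule has_field_derivative_transform_within_open[of "\<lambda>_. 1" _ _ "{t0<..}"])
      (use t unit in auto)
  ultimately have orth: "X t * X' t + Y t * Y' t = 0"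
    using DERIV_unique by fastforce
  have \<kappa>: "b * X t / y t - a * Y t / x t = X t * Y' t - X' t * Y t"
    using min[OF t] by simp
  have "X' t = - Y t * (X t * Y' t - X' t * Y t)" "Y' t = X t * (X t * Y' t - X' t * Y t)"
    using orth unit[OF t] by algebra+
  then show "(X has_real_derivative - Y t * (b * X t / y t - a * Y t / x t)) (at t)"
    "(Y has_real_derivative X t * (b * X t / y t - a * Y t / x t)) (at t)"
    unfolding \<kappa> using X[OF t] Y[OF t] by simp_all
qed (use assms in auto)

lemma profile_equations:
  assumes "smooth_on T x" "smooth_on T y" "t \<in> T"
    and "speed x y t = 1" "minimal_at p q x y t"
  shows "(x has_real_derivative deriv x t) (at t)" "(y has_real_derivative deriv y t) (at t)"
    and "(deriv x has_real_derivative deriv (deriv x) t) (at t)"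
    and "(deriv y has_real_derivative deriv (deriv y) t) (at t)"
    and "(deriv x t)\<^sup>2 + (deriv y t)\<^sup>2 = 1"
    and "deriv x t * deriv (deriv y) t - deriv (deriv x) t * deriv y t
      + (real q - 1) * (deriv y t / x t) - (real p - 1) * (deriv x t / y t) = 0"
proof -
  have "(deriv ^^ 0) f field_differentiable (at t)" "(deriv ^^ 1) f field_differentiable (at t)"
    if "smooth_on T f" for f
    using that assms(3) unfolding smooth_on_def by blast+
  then have *: "(f has_real_derivative deriv f t) (at t)"
      "(deriv f has_real_derivative deriv (deriv f) t) (at t)" if "smooth_on T f" for f
    using that by (auto simp: DERIV_deriv_iff_field_differentiable)
  show "(x has_real_derivative deriv x t) (at t)" "(y has_real_derivative deriv y t) (at t)"
    "(deriv x has_real_derivative deriv (deriv x) t) (at t)"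
    "(deriv y has_real_derivative deriv (deriv y) t) (at t)"
    using * assms(1,2) by auto
  show "(deriv x t)\<^sup>2 + (deriv y t)\<^sup>2 = 1"
    using assms(4) by (simp add: speed_def)
  show "deriv x t * deriv (deriv y) t - deriv (deriv x) t * deriv y t
      + (real q - 1) * (deriv y t / x t) - (real p - 1) * (deriv x t / y t) = 0"
    using assms(4,5) by (simp add: minimal_at_def lambda1_def lambda2_def lambda3_def)
qed

text \<open>Each side of \<open>t0\<close> is a minimal branch, the left one after the reflection of
  t to -t. The distance formula is kept because it shows that each branch covers its whole
  half-line.\<close>

lemma cusp_profile_on_cone:
  assumes p: "p \<ge> 2" and q: "q \<ge> 2" and \<gamma>: "cusp_profile p q t0 \<gamma>"
  shows "(real p - 1) * (fst (\<gamma> t))\<^sup>2 = (real q - 1) * (snd (\<gamma> t))\<^sup>2"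
    and "sqrt ((fst (\<gamma> t))\<^sup>2 + (snd (\<gamma> t))\<^sup>2) = \<bar>t - t0\<bar>"
proof -
  define x where "x = fst \<circ> \<gamma>"
  define y where "y = snd \<circ> \<gamma>"
  have pq: "real q - 1 \<ge> 1" "real p - 1 \<ge> 1" using p q by simp_all
  have cont: "continuous_on UNIV \<gamma>" and 0: "\<gamma> t0 = (0, 0)"
    and Q1: "\<And>t. t \<noteq> t0 \<Longrightarrow> \<gamma> t \<in> Q1"
    using \<gamma> unfolding cusp_profile_def by blast+
  have pos: "x t > 0" "y t > 0" if "t \<noteq> t0" for t
    using Q1[OF that] by (auto simp: Q1_def x_def y_def split: prod.splits)
  have xy0: "x t0 = 0" "y t0 = 0" using 0 by (simp_all add: x_def y_def)
  have "isCont \<gamma> t0" using cont by (simp add: continuous_on_eq_continuous_at)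
  then have "isCont x t0" "isCont y t0" unfolding x_def y_def comp_def
    by (auto intro: isCont_fst isCont_snd)
  then have lims: "(x \<longlongrightarrow> 0) (at t0)" "(y \<longlongrightarrow> 0) (at t0)"
    using xy0 by (simp_all add: isCont_def)
  then have right: "(x \<longlongrightarrow> 0) (at_right t0)" "(y \<longlongrightarrow> 0) (at_right t0)"
    and left: "(x \<longlongrightarrow> 0) (at_left t0)" "(y \<longlongrightarrow> 0) (at_left t0)"
    by (auto simp: filterlim_at_split)
  have reflected: "((\<lambda>t. x (- t)) \<longlongrightarrow> 0) (at_right (- t0))" "((\<lambda>t. y (- t)) \<longlongrightarrow> 0) (at_right (- t0))"
    using left by (auto simp: filterlim_at_left_to_right at_left_minus filterlim_filtermap)
  note eqs = profile_equations[where x = x and y = y and p = p and q = q]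
  have sm: "smooth_on {t0<..} x" "smooth_on {t0<..} y" "smooth_on {..<t0} x" "smooth_on {..<t0} y"
    and sp: "\<And>t. t \<noteq> t0 \<Longrightarrow> speed x y t = 1" "\<And>t. t \<noteq> t0 \<Longrightarrow> minimal_at p q x y t"
    using \<gamma> unfolding cusp_profile_def x_def[symmetric] y_def[symmetric]
    by (auto simp: neq_iff)
  note eqR = eqs[OF sm(1,2) _ sp] and eqL = eqs[OF sm(3,4) _ sp]
  interpret R: minimal_branch "real q - 1" "real p - 1" t0 x y "deriv x" "deriv y"
    by (rule minimal_branchI[where X' = "deriv (deriv x)" and Y' = "deriv (deriv y)"])
      (use pq pos right eqR in auto)
  interpret L: minimal_branch "real q - 1" "real p - 1" "- t0" "\<lambda>t. x (- t)" "\<lambda>t. y (- t)"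
      "\<lambda>t. - deriv x (- t)" "\<lambda>t. - deriv y (- t)"
  \<comment> \<open>Under reflection first derivatives change sign and second derivatives do not, so
    the left side of the minimality equation only changes sign.\<close>
  proof (rule minimal_branchI[where X' = "\<lambda>t. deriv (deriv x) (- t)" and Y' = "\<lambda>t. deriv (deriv y) (- t)"])
    fix t assume "t > - t0"
    then have t: "- t \<in> {..<t0}" "- t \<noteq> t0" by auto
    note e = eqL[OF t(1) t(2) t(2)]
    show "((\<lambda>t. x (- t)) has_real_derivative - deriv x (- t)) (at t)"
      "((\<lambda>t. y (- t)) has_real_derivative - deriv y (- t)) (at t)"
      using e(1,2) by (simp_all add: DERIV_mirror)
    show "((\<lambda>t. - deriv x (- t)) has_real_derivative deriv (deriv x) (- t)) (at t)"
      "((\<lambda>t. - deriv y (- t)) has_real_derivative deriv (deriv y) (- t)) (at t)"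
      using DERIV_minus[OF e(3)[unfolded DERIV_mirror]] DERIV_minus[OF e(4)[unfolded DERIV_mirror]]
      by simp_all
    show "(- deriv x (- t))\<^sup>2 + (- deriv y (- t))\<^sup>2 = 1" using e(5) by simp
    show "x (- t) > 0" "y (- t) > 0" using pos[OF t(2)] by auto
    show "- deriv x (- t) * deriv (deriv y) (- t) - deriv (deriv x) (- t) * - deriv y (- t)
        + (real q - 1) * (- deriv y (- t) / x (- t)) - (real p - 1) * (- deriv x (- t) / y (- t)) = 0"
      using e(6) by simp
  qed (use pq reflected in auto)
  show "(real p - 1) * (fst (\<gamma> t))\<^sup>2 = (real q - 1) * (snd (\<gamma> t))\<^sup>2"
    using R.on_cone(1)[of t] L.on_cone(1)[of "- t"] 0
    by (cases t t0 rule: linorder_cases) (auto simp: x_def y_def)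
  have r: "R.r t = sqrt ((x t)\<^sup>2 + (y t)\<^sup>2)" "L.r (- t) = sqrt ((x t)\<^sup>2 + (y t)\<^sup>2)"
    by (simp_all add: R.r_def L.r_def)
  have "sqrt ((x t)\<^sup>2 + (y t)\<^sup>2) = \<bar>t - t0\<bar>"
    using R.on_cone(2)[of t] L.on_cone(2)[of "- t"] 0
    by (cases t t0 rule: linorder_cases) (auto simp: xy0 r)
  then show "sqrt ((fst (\<gamma> t))\<^sup>2 + (snd (\<gamma> t))\<^sup>2) = \<bar>t - t0\<bar>"
    by (simp add: x_def y_def)
qed

lemma range_cusp_profile:
  assumes p: "p \<ge> 2" and q: "q \<ge> 2" and \<gamma>: "cusp_profile p q t0 \<gamma>"
  shows "range \<gamma> = {(u, v). u \<ge> 0 \<and> v = sqrt ((real p - 1) / (real q - 1)) * u}"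
proof -
  define \<tau> where "\<tau> = sqrt ((real p - 1) / (real q - 1))"
  have \<tau>: "\<tau> > 0" "\<tau>\<^sup>2 = (real p - 1) / (real q - 1)" using p q by (simp_all add: \<tau>_def)
  note cone = cusp_profile_on_cone[OF p q \<gamma>]
  have nonneg: "fst (\<gamma> t) \<ge> 0" "snd (\<gamma> t) \<ge> 0" for t
  proof -
    have "\<gamma> t \<in> insert (0, 0) Q1" using \<gamma> unfolding cusp_profile_def by (cases "t = t0") auto
    then show "fst (\<gamma> t) \<ge> 0" "snd (\<gamma> t) \<ge> 0" by (auto simp: Q1_def)
  qed
  have slope: "snd (\<gamma> t) = \<tau> * fst (\<gamma> t)" for t
  proof (rule power2_eq_imp_eq)
    show "(snd (\<gamma> t))\<^sup>2 = (\<tau> * fst (\<gamma> t))\<^sup>2"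
      using cone(1)[of t] p q by (simp add: power_mult_distrib \<tau>(2) field_simps)
  qed (use nonneg \<tau> in auto)
  have onto: "(u, \<tau> * u) \<in> range \<gamma>" if u: "u \<ge> 0" for u
  proof -
    \<comment> \<open>The parameter on the right branch at which the distance to the origin is that
      of the target point.\<close>
    define t where "t = t0 + sqrt (u\<^sup>2 + (\<tau> * u)\<^sup>2)"
    have "sqrt ((fst (\<gamma> t))\<^sup>2 + (snd (\<gamma> t))\<^sup>2) = sqrt (u\<^sup>2 + (\<tau> * u)\<^sup>2)"
      unfolding cone(2) by (simp add: t_def)
    then have "(fst (\<gamma> t))\<^sup>2 * (1 + \<tau>\<^sup>2) = u\<^sup>2 * (1 + \<tau>\<^sup>2)"
      unfolding slope by (simp add: algebra_simps)
    moreover have "1 + \<tau>\<^sup>2 > 0" by (simp add: add_pos_nonneg)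
    ultimately have "(fst (\<gamma> t))\<^sup>2 = u\<^sup>2" by simp
    then have "fst (\<gamma> t) = u" using nonneg(1) u by (rule power2_eq_imp_eq)
    then have "\<gamma> t = (u, \<tau> * u)" using slope[of t] by (simp add: prod_eq_iff)
    then show ?thesis by (metis rangeI)
  qed
  have "\<gamma> t \<in> {(u, v). u \<ge> 0 \<and> v = \<tau> * u}" for t
    using nonneg(1)[of t] slope[of t] by (simp add: case_prod_beta)
  then have "range \<gamma> \<subseteq> {(u, v). u \<ge> 0 \<and> v = \<tau> * u}" by (rule image_subsetI)
  moreover have "{(u, v). u \<ge> 0 \<and> v = \<tau> * u} \<subseteq> range \<gamma>" using onto by auto
  ultimately show ?thesis unfolding \<tau>_def by (rule equalityI)
qed

section \<open>The cone as a cusp profile\<close>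

lemma affine_on_deriv:
  fixes f :: "real \<Rightarrow> real"
  assumes "open T" "\<And>t. t \<in> T \<Longrightarrow> f t = m * t + d" "t \<in> T"
  shows "(f has_real_derivative m) (at t)" and "deriv f t = m"
proof -
  show "(f has_real_derivative m) (at t)"
    by (rule has_field_derivative_transform_within_open[of "\<lambda>t. m * t + d" _ _ T])
      (use assms in \<open>auto intro!: derivative_eq_intros\<close>)
  then show "deriv f t = m" by (rule DERIV_imp_deriv)
qed

text \<open>Every iterated derivative is again affine on \<open>T\<close>. The localization to an
  open set is for \<bar>t\<bar>, which is affine only on each open half-line.\<close>

lemma affine_on_smooth:
  assumes T: "open T" and f: "\<And>t. t \<in> T \<Longrightarrow> f t = m * t + d"
  shows "smooth_on T f"
proof -
  have "\<exists>m d. \<forall>t\<in>T. (deriv ^^ k) f t = m * t + d" for k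
  proof (induction k)
    case 0
    then show ?case using f by auto
  next
    case (Suc k)
    then obtain m d where "\<forall>t\<in>T. (deriv ^^ k) f t = m * t + d" by blast
    then have "\<forall>t\<in>T. (deriv ^^ Suc k) f t = 0 * t + m"
      using affine_on_deriv(2)[OF T, of "(deriv ^^ k) f"] by simp
    then show ?case by blast
  qed
  then show ?thesis unfolding smooth_on_def field_differentiable_def
    using affine_on_deriv(1)[OF T] by meson
qed

lemma affine_profile_curvatures:
  assumes T: "open T" and x: "\<And>t. t \<in> T \<Longrightarrow> x t = m * t" and y: "\<And>t. t \<in> T \<Longrightarrow> y t = n * t"
    and mn: "m\<^sup>2 + n\<^sup>2 = 1" and t: "t \<in> T"
  shows "speed x y t = 1" "lambda1 x y t = 0" "lambda2 x y t = n / (m * t)" "lambda3 x y t = - (m / (n * t))"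
proof -
  have d: "deriv x t = m" "deriv y t = n" if "t \<in> T" for t
    using affine_on_deriv(2)[OF T, of x m 0] affine_on_deriv(2)[OF T, of y n 0] x y that by auto
  have dd: "deriv (deriv x) t = 0" "deriv (deriv y) t = 0"
    using affine_on_deriv(2)[OF T, of "deriv x" 0 m] affine_on_deriv(2)[OF T, of "deriv y" 0 n] d t by auto
  show s: "speed x y t = 1" using d[OF t] mn by (simp add: speed_def)
  show "lambda1 x y t = 0" "lambda2 x y t = n / (m * t)" "lambda3 x y t = - (m / (n * t))"
    unfolding lambda1_def lambda2_def lambda3_def s d[OF t] dd x[OF t] y[OF t] by simp_all
qed

lemma alpha0_trig:
  assumes "p \<ge> 2" "q \<ge> 2"
  shows "cos (alpha0 p q) > 0" "sin (alpha0 p q) > 0"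
    and "tan (alpha0 p q) = sqrt ((real p - 1) / (real q - 1))"
    and "(real q - 1) * (sin (alpha0 p q))\<^sup>2 = (real p - 1) * (cos (alpha0 p q))\<^sup>2"
proof -
  show c: "cos (alpha0 p q) > 0" unfolding alpha0_def
    by (intro cos_gt_zero_pi arctan_lbound arctan_ubound)
  show t: "tan (alpha0 p q) = sqrt ((real p - 1) / (real q - 1))"
    unfolding alpha0_def by (rule tan_arctan)
  have s: "sin (alpha0 p q) = tan (alpha0 p q) * cos (alpha0 p q)" using c by (simp add: tan_def)
  moreover have "tan (alpha0 p q) > 0" unfolding t using assms by simp
  ultimately show "sin (alpha0 p q) > 0" using c by simp
  show "(real q - 1) * (sin (alpha0 p q))\<^sup>2 = (real p - 1) * (cos (alpha0 p q))\<^sup>2"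
    unfolding s t using assms by (simp add: power_mult_distrib)
qed

text \<open>The curve runs into the origin along the ray and leaves along the same ray, so its two
  branches have the same image.\<close>

lemma cusp_profile_cone:
  assumes p: "p \<ge> 2" and q: "q \<ge> 2"
  shows "cusp_profile p q 0 (\<lambda>t. (\<bar>t\<bar> * cos (alpha0 p q), \<bar>t\<bar> * sin (alpha0 p q)))"
proof -
  let ?c = "cos (alpha0 p q)" and ?s = "sin (alpha0 p q)"
  let ?x = "\<lambda>t. \<bar>t\<bar> * ?c" and ?y = "\<lambda>t. \<bar>t\<bar> * ?s"
  note trig = alpha0_trig[OF p q]
  have "smooth_on T ?x \<and> smooth_on T ?y \<and> (\<forall>t\<in>T. speed ?x ?y t = 1 \<and> minimal_at p q ?x ?y t)"
    if T: "T = {..<0} \<or> T = {0<..}" for T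
  proof -
    \<comment> \<open>The sign \<open>e\<close> treats both half-lines at once.\<close>
    obtain e :: real where e: "e\<^sup>2 = 1" "\<And>t. t \<in> T \<Longrightarrow> \<bar>t\<bar> = e * t"
      using T
    proof
      assume "T = {..<0}"
      then show thesis using that[of "-1"] by auto
    next
      assume "T = {0<..}"
      then show thesis using that[of 1] by auto
    qed
    have op: "open T" and 0: "0 \<notin> T" using T by auto
    have x: "?x t = (e * ?c) * t" and y: "?y t = (e * ?s) * t" if "t \<in> T" for t
      using e(2)[OF that] by simp_all
    have unit: "(e * ?c)\<^sup>2 + (e * ?s)\<^sup>2 = 1"
      using e(1) by (simp add: power_mult_distrib)
    have curv: "speed ?x ?y t = 1" "lambda1 ?x ?y t = 0"
      "lambda2 ?x ?y t = (e * ?s) / ((e * ?c) * t)" "lambda3 ?x ?y t = - ((e * ?c) / ((e * ?s) * t))"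
      if "t \<in> T" for t
      by (rule affine_profile_curvatures[OF op _ _ unit that]; rule x y; assumption)+
    have e0: "e \<noteq> 0" using e(1) by auto
    have "minimal_at p q ?x ?y t" if t: "t \<in> T" for t
    proof -
      have "t \<noteq> 0" using 0 t by blast
      \<comment> \<open>Over a common denominator, minimality becomes the identity that defines
        \<open>alpha0\<close>.\<close>
      then have "e * ?s / (e * ?c * t) = ?s\<^sup>2 / (?c * ?s * t)" "e * ?c / (e * ?s * t) = ?c\<^sup>2 / (?c * ?s * t)"
        using trig(1,2) e0 by (simp_all add: field_simps power2_eq_square)
      moreover have "(real q - 1) * (?s\<^sup>2 / (?c * ?s * t)) = (real p - 1) * (?c\<^sup>2 / (?c * ?s * t))"
        using trig(4) by simp
      ultimately show ?thesis
        unfolding minimal_at_def curv(2-4)[OF t] by simp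
    qed
    moreover have "smooth_on T ?x"
      by (rule affine_on_smooth[OF op, where m = "e * ?c" and d = 0]) (simp add: e(2))
    moreover have "smooth_on T ?y"
      by (rule affine_on_smooth[OF op, where m = "e * ?s" and d = 0]) (simp add: e(2))
    ultimately show ?thesis using curv(1) by blast
  qed
  moreover have "fst \<circ> (\<lambda>t. (?x t, ?y t)) = ?x" "snd \<circ> (\<lambda>t. (?x t, ?y t)) = ?y" by auto
  ultimately show ?thesis unfolding cusp_profile_def
    using trig(1,2) by (auto simp: Q1_def intro!: continuous_intros)
qed

section \<open>Hypersurfaces and their orbit images\<close>

lemma polar_decomposition:
  fixes U :: "real ^ 'n"
  obtains \<xi> where "norm \<xi> = 1" "U = norm U *\<^sub>R \<xi>"
proof (cases "U = 0")
  case True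
  \<comment> \<open>The zero vector has no direction of its own; any unit vector serves.\<close>
  then show ?thesis using that[of "axis undefined 1"] by (simp add: norm_axis_1)
next
  case False
  then show ?thesis using that[of "U /\<^sub>R norm U"] by simp
qed

lemma mem_OO_cone_iff:
  fixes U :: "real ^ 'q" and V :: "real ^ 'p"
  assumes "CARD('p) \<ge> 2" "CARD('q) \<ge> 2"
  shows "(U, V) \<in> OO_cone \<longleftrightarrow> norm V = sqrt ((real CARD('p) - 1) / (real CARD('q) - 1)) * norm U"
    (is "_ \<longleftrightarrow> _ = ?\<tau> * _")
proof -
  have "(U, V) \<in> OO_cone \<longleftrightarrow> (norm V)\<^sup>2 = (?\<tau> * norm U)\<^sup>2"
    using assms by (simp add: OO_cone_def power_mult_distrib field_simps)
  also have "\<dots> \<longleftrightarrow> norm V = ?\<tau> * norm U"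
    using assms by (intro power2_eq_iff_nonneg) auto
  finally show ?thesis .
qed

text \<open>The generated set depends only on the image of the curve. The parameter set is left free
  so that both full cusp profiles and the closed half-line are covered.\<close>

lemma generated_by_ray:
  fixes \<gamma> :: "real \<Rightarrow> real \<times> real"
  assumes card: "CARD('p) \<ge> 2" "CARD('q) \<ge> 2"
    and ray: "\<gamma> ` T = {(u, v). u \<ge> 0 \<and> v = sqrt ((real CARD('p) - 1) / (real CARD('q) - 1)) * u}"
  shows "generated_by T \<gamma> = (OO_cone :: ((real ^ 'q) \<times> (real ^ 'p)) set)"
proof (intro set_eqI iffI)
  fix z :: "(real ^ 'q) \<times> (real ^ 'p)"
  assume "z \<in> generated_by T \<gamma>"
  then obtain t \<xi> \<eta> where z: "z = (fst (\<gamma> t) *\<^sub>R \<xi>, snd (\<gamma> t) *\<^sub>R \<eta>)"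
    and t: "t \<in> T" and unit: "norm \<xi> = 1" "norm \<eta> = 1"
    unfolding generated_by_def by blast
  have "\<gamma> t \<in> \<gamma> ` T" using t by simp
  then show "z \<in> OO_cone"
    unfolding ray z mem_OO_cone_iff[OF card] using unit card by (auto simp: abs_mult)
next
  fix z :: "(real ^ 'q) \<times> (real ^ 'p)"
  assume z: "z \<in> OO_cone"
  obtain U V where UV: "z = (U, V)" by (cases z)
  have "(norm U, norm V) \<in> \<gamma> ` T"
    using z unfolding ray UV mem_OO_cone_iff[OF card] by simp
  then obtain t where t: "t \<in> T" "\<gamma> t = (norm U, norm V)" by force
  obtain \<xi> where \<xi>: "norm \<xi> = 1" "U = norm U *\<^sub>R \<xi>" by (rule polar_decomposition)
  obtain \<eta> where \<eta>: "norm \<eta> = 1" "V = norm V *\<^sub>R \<eta>" by (rule polar_decomposition)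
  show "z \<in> generated_by T \<gamma>"
    unfolding generated_by_def UV using t \<xi> \<eta> by force
qed

lemma OO_invariant_cone: "OO_invariant (OO_cone :: ((real ^ 'q) \<times> (real ^ 'p)) set)"
  unfolding OO_invariant_def
proof (intro allI impI)
  fix A :: "real ^ 'q \<Rightarrow> real ^ 'q" and B :: "real ^ 'p \<Rightarrow> real ^ 'p"
  assume AB: "orthogonal_transformation A \<and> orthogonal_transformation B"
  have iff: "(A U, B V) \<in> OO_cone \<longleftrightarrow> (U, V) \<in> OO_cone" for U V
    using AB by (simp add: OO_cone_def orthogonal_transformation_norm)
  have "z \<in> (\<lambda>(U, V). (A U, B V)) ` OO_cone" if z: "z \<in> OO_cone" for z
  proof -
    obtain U V where "z = (A U, B V)"
      using AB by (metis orthogonal_transformation_surj surjD surj_pair)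
    then show ?thesis using z iff by force
  qed
  then show "(\<lambda>(U, V). (A U, B V)) ` OO_cone = OO_cone"
    using iff by auto
qed

theorem theorem1p2:
  fixes p q :: nat and C :: "((real ^ 'q) \<times> (real ^ 'p)) set"
    and x y :: "real \<Rightarrow> real" and ray :: "(real \<times> real) set"
  assumes "CARD('p) = p" and "CARD('q) = q" and "p \<ge> 2" and "q \<ge> 2"
  defines "C \<equiv> OO_cone"
    and "ray \<equiv> {(a, b). a \<ge> 0 \<and> b = tan (alpha0 p q) * a}"
    and "x \<equiv> \<lambda>t. t * cos (alpha0 p q)"
    and "y \<equiv> \<lambda>t. t * sin (alpha0 p q)"
  shows "(\<forall>S :: ((real ^ 'q) \<times> (real ^ 'p)) set. minimal_hypersurface_with_cusp S \<longleftrightarrow> S = C) \<and>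
     tan (alpha0 p q) = sqrt ((real p - 1) / (real q - 1)) \<and>
     orbit_map ` C = ray \<and>
     (\<forall>t0 \<gamma>. cusp_profile p q t0 \<gamma> \<longrightarrow> range \<gamma> = ray) \<and>
     insert (0, 0) (generated_by {0<..} (\<lambda>t. (x t, y t))) = C \<and>
     (\<forall>t>0. (x t, y t) \<in> Q1 \<and>
        lambda1 x y t = 0 \<and>
        lambda2 x y t = 1 / t * sqrt ((real p - 1) / (real q - 1)) \<and>
        lambda3 x y t = - (1 / t * sqrt ((real q - 1) / (real p - 1))))"
proof (intro conjI)
  note trig = alpha0_trig[OF \<open>p \<ge> 2\<close> \<open>q \<ge> 2\<close>]
  have card: "CARD('p) \<ge> 2" "CARD('q) \<ge> 2" using assms by simp_all
  have ray: "ray = {(u, v). u \<ge> 0 \<and> v = sqrt ((real CARD('p) - 1) / (real CARD('q) - 1)) * u}"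
    unfolding ray_def trig(3) assms(1,2) ..
  have range: "range \<gamma> = ray" if "cusp_profile p q t0 \<gamma>" for t0 \<gamma>
    using range_cusp_profile[OF assms(3,4) that] unfolding ray_def trig(3) .
  have gen: "generated_by T \<gamma> = C" if "\<gamma> ` T = ray" for T \<gamma>
    unfolding C_def using that unfolding ray by (rule generated_by_ray[OF card])
  show "\<forall>S :: ((real ^ 'q) \<times> (real ^ 'p)) set. minimal_hypersurface_with_cusp S \<longleftrightarrow> S = C"
  proof (intro allI iffI)
    fix S :: "((real ^ 'q) \<times> (real ^ 'p)) set"
    assume "minimal_hypersurface_with_cusp S"
    then obtain t0 \<gamma> where "cusp_profile p q t0 \<gamma>" "S = generated_by UNIV \<gamma>"
      unfolding minimal_hypersurface_with_cusp_def assms(1,2) by blast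
    then show "S = C" using gen range by simp
  next
    fix S :: "((real ^ 'q) \<times> (real ^ 'p)) set"
    assume S: "S = C"
    have "OO_invariant S" unfolding S C_def by (rule OO_invariant_cone)
    moreover note profile = cusp_profile_cone[OF assms(3,4)]
    moreover have "S = generated_by UNIV (\<lambda>t. (\<bar>t\<bar> * cos (alpha0 p q), \<bar>t\<bar> * sin (alpha0 p q)))"
      unfolding S using gen[OF range[OF profile]] ..
    ultimately show "minimal_hypersurface_with_cusp S"
      unfolding minimal_hypersurface_with_cusp_def assms(1,2) by blast
  qed
  show "tan (alpha0 p q) = sqrt ((real p - 1) / (real q - 1))" by (rule trig(3))
  show "\<forall>t0 \<gamma>. cusp_profile p q t0 \<gamma> \<longrightarrow> range \<gamma> = ray" using range by blast
  show "orbit_map ` C = ray"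
  proof (intro equalityI subsetI)
    fix z assume "z \<in> orbit_map ` C"
    then show "z \<in> ray"
      unfolding C_def ray orbit_map_def using mem_OO_cone_iff[OF card] by auto
  next
    fix z assume "z \<in> ray"
    then obtain u v where z: "z = (u, v)" "u \<ge> 0"
      "v = sqrt ((real CARD('p) - 1) / (real CARD('q) - 1)) * u"
      unfolding ray by blast
    have "v \<ge> 0" using z card by simp
    then obtain U :: "real ^ 'q" and V :: "real ^ 'p" where UV: "norm U = u" "norm V = v"
      using vector_choose_size \<open>u \<ge> 0\<close> by metis
    then have "(U, V) \<in> C" unfolding C_def mem_OO_cone_iff[OF card] using z by simp
    then show "z \<in> orbit_map ` C" unfolding z(1) orbit_map_def using UV by force
  qed
  \<comment> \<open>The half-line is closed so that its image contains the vertex; the parameter 0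
    is exchanged below for the inserted origin.\<close>
  have half_line: "(\<lambda>t. (x t, y t)) ` {0..} = ray"
  proof (intro equalityI subsetI)
    fix z assume "z \<in> (\<lambda>t. (x t, y t)) ` {0..}"
    then show "z \<in> ray" using trig(1) by (auto simp: ray_def x_def y_def tan_def)
  next
    fix z assume "z \<in> ray"
    then obtain u where u: "z = (u, tan (alpha0 p q) * u)" "u \<ge> 0" unfolding ray_def by blast
    then have "z = (x (u / cos (alpha0 p q)), y (u / cos (alpha0 p q)))" "u / cos (alpha0 p q) \<ge> 0"
      using trig(1) by (auto simp: x_def y_def tan_def)
    then show "z \<in> (\<lambda>t. (x t, y t)) ` {0..}" by blast
  qed
  show "insert (0, 0) (generated_by {0<..} (\<lambda>t. (x t, y t))) = C"
  proof -
    \<comment> \<open>The parameter 0 contributes the origin because both unit spheres are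
      nonempty.\<close>
    obtain \<xi> :: "real ^ 'q" and \<eta> :: "real ^ 'p" where unit: "norm \<xi> = 1" "norm \<eta> = 1"
      using vector_choose_size[of 1] by (metis zero_le_one)
    have "insert (0, 0) (generated_by {0<..} (\<lambda>t. (x t, y t)))
        = (generated_by {0..} (\<lambda>t. (x t, y t)) :: ((real ^ 'q) \<times> (real ^ 'p)) set)"
    proof (intro equalityI subsetI)
      fix z :: "(real ^ 'q) \<times> (real ^ 'p)"
      assume "z \<in> insert (0, 0) (generated_by {0<..} (\<lambda>t. (x t, y t)))"
      moreover have "(0, 0) \<in> (generated_by {0..} (\<lambda>t. (x t, y t)) :: ((real ^ 'q) \<times> (real ^ 'p)) set)"
        unfolding generated_by_def using unit
        by (intro CollectI exI[of _ 0] exI[of _ \<xi>] exI[of _ \<eta>]) (simp add: x_def y_def)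
      moreover have "generated_by {0<..} (\<lambda>t. (x t, y t)) \<subseteq> generated_by {0..} (\<lambda>t. (x t, y t))"
        unfolding generated_by_def using less_imp_le by fast
      ultimately show "z \<in> generated_by {0..} (\<lambda>t. (x t, y t))" by blast
    next
      fix z :: "(real ^ 'q) \<times> (real ^ 'p)"
      assume "z \<in> generated_by {0..} (\<lambda>t. (x t, y t))"
      then obtain t \<xi> \<eta> where t: "z = (x t *\<^sub>R \<xi>, y t *\<^sub>R \<eta>)" "t \<ge> 0" "norm \<xi> = 1" "norm \<eta> = 1"
        unfolding generated_by_def by auto
      show "z \<in> insert (0, 0) (generated_by {0<..} (\<lambda>t. (x t, y t)))"
      proof (cases "t = 0")
        case True
        then show ?thesis using t by (simp add: x_def y_def)
      next
        case False
        then have "t \<in> {0<..}" using t by simp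
        then show ?thesis unfolding generated_by_def using t by force
      qed
    qed
    then show ?thesis using gen[OF half_line] by simp
  qed
  show "\<forall>t>0. (x t, y t) \<in> Q1 \<and> lambda1 x y t = 0 \<and>
        lambda2 x y t = 1 / t * sqrt ((real p - 1) / (real q - 1)) \<and>
        lambda3 x y t = - (1 / t * sqrt ((real q - 1) / (real p - 1)))"
  proof (intro allI impI)
    fix t :: real assume t: "t > 0"
    have "(cos (alpha0 p q))\<^sup>2 + (sin (alpha0 p q))\<^sup>2 = 1" by simp
    note curv = affine_profile_curvatures[OF open_greaterThan _ _ this, of 0 x y t]
    have "sqrt ((real q - 1) / (real p - 1)) = inverse (tan (alpha0 p q))"
      unfolding trig(3) by (simp flip: real_sqrt_inverse)
    then have cot: "sqrt ((real q - 1) / (real p - 1)) = cos (alpha0 p q) / sin (alpha0 p q)"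
      by (simp add: tan_def)
    have "lambda1 x y t = 0" "lambda2 x y t = sin (alpha0 p q) / (cos (alpha0 p q) * t)"
      "lambda3 x y t = - (cos (alpha0 p q) / (sin (alpha0 p q) * t))"
      using curv t by (simp_all add: x_def y_def)
    moreover have "(x t, y t) \<in> Q1" using t trig(1,2) by (simp add: Q1_def x_def y_def)
    ultimately show "(x t, y t) \<in> Q1 \<and> lambda1 x y t = 0 \<and>
        lambda2 x y t = 1 / t * sqrt ((real p - 1) / (real q - 1)) \<and>
        lambda3 x y t = - (1 / t * sqrt ((real q - 1) / (real p - 1)))"
      unfolding trig(3)[symmetric] cot by (simp add: tan_def mult.commute)
  qed
qed

end
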